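(* Let $\pi_1,\pi_2$ be possibility distributions on a finite set $\mathcal{X}$, with induced possibility measures $\Pi_1,\Pi_2$, and let $\overline{P}(A)=\min\{\Pi_1(A),\Pi_2(A)\}$ for all $A\subseteq\mathcal{X}$. Then $\overline{P}$ is a possibility measure if and only if $$\min\Big\{\max_{x\in A}\pi_1(x),\ \max_{x\in A}\pi_2(x)\Big\}=\max_{x\in A}\min\{\pi_1(x),\pi_2(x)\}$$ for all non-empty $A\subseteq\mathcal{X}$. In such a case, the natural extension $\overline{E}$ of $\overline{P}$ coincides with $\overline{P}$, and hence $\overline{E}$ is a possibility measure as well.
   Context: $\mathcal{X}$ is a finite set and $\wp(\mathcal{X})$ its power set. A possibility distribution on $\mathcal{X}$ is a function $\pi\colon\mathcal{X}\to[0,1]$ with $\max_{x\in\mathcal{X}}\pi(x)=1$. It induces the possibility measure $\Pi\colon\wp(\mathcal{X})\to[0,1]$, $\Pi(A)=\max_{x\in A}\pi(x)$, with $\Pi(\emptyset)=0$. A set function is called a possibility measure if it is induced in this way by some possibility distribution. An upper probability is a function $\overline{P}\colon\wp(\mathcal{X})\to[0,1]$. Its credal set $\mathcal{M}$ is the set of all (finitely additive) probability measures $Q$ on $\wp(\mathcal{X})$ with $Q(A)\le\overline{P}(A)$ for all $A\subseteq\mathcal{X}$. $\overline{P}$ avoids sure loss if $\mathcal{M}\neq\emptyset$; in that case its natural extension is $\overline{E}(A)=\max_{Q\in\mathcal{M}}Q(A)$ for $A\subseteq\mathcal{X}$. The assertion that $\overline{E}$ coincides with $\overline{P}$ includes that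 $\overline{P}$ avoids sure loss, so that $\overline{E}$ exists. *)

theory Defs
  imports "HOL-Analysis.Measure_Space"
begin

text \<open>Set functions on the power set of \<open>X\<close> are modelled as functions of type \<open>'a set \<Rightarrow> real\<close>; only
  their values on subsets of \<open>X\<close> matter.\<close>

text \<open>\<open>X \<noteq> {}\<close> is required because \<^const>\<open>Max\<close> is unspecified on the empty set.\<close>

definition possibility_distribution :: "'a set \<Rightarrow> ('a \<Rightarrow> real) \<Rightarrow> bool" where
  "possibility_distribution X \<pi> \<longleftrightarrow>
     X \<noteq> {} \<and> (\<forall>x\<in>X. \<pi> x \<in> {0..1}) \<and> Max (\<pi> ` X) = 1"

definition induced_possibility :: "('a \<Rightarrow> real) \<Rightarrow> 'a set \<Rightarrow> real" where
  "induced_possibility \<pi> A = (if A = {} then 0 else Max (\<pi> ` A))"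

definition possibility_measure :: "'a set \<Rightarrow> ('a set \<Rightarrow> real) \<Rightarrow> bool" where
  "possibility_measure X P \<longleftrightarrow>
     (\<exists>\<pi>. possibility_distribution X \<pi> \<and> (\<forall>A\<subseteq>X. P A = induced_possibility \<pi> A))"

definition fin_additive_probability :: "'a set \<Rightarrow> ('a set \<Rightarrow> real) \<Rightarrow> bool" where
  "fin_additive_probability X Q \<longleftrightarrow>
     (\<forall>A\<subseteq>X. 0 \<le> Q A) \<and> Q X = 1 \<and> Measure_Space.additive (Pow X) Q"

definition credal_set :: "'a set \<Rightarrow> ('a set \<Rightarrow> real) \<Rightarrow> ('a set \<Rightarrow> real) set" where
  "credal_set X P = {Q. fin_additive_probability X Q \<and> (\<forall>A\<subseteq>X. Q A \<le> P A)}"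

definition avoids_sure_loss :: "'a set \<Rightarrow> ('a set \<Rightarrow> real) \<Rightarrow> bool" where
  "avoids_sure_loss X P \<longleftrightarrow> credal_set X P \<noteq> {}"

text \<open>A maximum over a possibly infinite set of reals: \<^const>\<open>Max\<close> is meaningful only for finite
  sets, so the greatest element is selected with \<open>GREATEST\<close>, which requires it to be attained.\<close>

definition natural_extension :: "'a set \<Rightarrow> ('a set \<Rightarrow> real) \<Rightarrow> 'a set \<Rightarrow> real" where
  "natural_extension X P A = (GREATEST v. v \<in> (\<lambda>Q. Q A) ` credal_set X P)"

end

theory Submission
  imports Defs
begin

text \<open>A possibility measure is determined by its values on singletons, so the only distribution that can
  induce \<open>P\<close> is the pointwise minimum of \<open>\<pi>\<^sub>1\<close> and \<open>\<pi>\<^sub>2\<close>; the identity of maxima says that it does. Its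
  instance \<open>A = X\<close> moreover gives the normalisation \<open>max (min \<pi>\<^sub>1 \<pi>\<^sub>2) = min 1 1 = 1\<close>, so a
  distribution is obtained for free. Lemma \<open>possibility_measure_iff_induced_by_singletons\<close> carries this
  part.

  The claim on the natural extension holds for every possibility measure \<open>\<Pi>\<close>. Each value \<open>\<Pi> A\<close> bounds
  the credal set from above by definition, so it remains to attain it by a probability measure
  below \<open>\<Pi>\<close>, and a two-point measure suffices. For non-empty \<open>A\<close>, let \<open>t\<close> be a point of possibility 1
  and \<open>a\<close> a point of greatest possibility in \<open>A\<close>; put mass \<open>\<pi> a\<close> on \<open>a\<close> and the rest on \<open>t\<close>. A set that
  contains \<open>t\<close> has possibility 1, so its upper bound is trivial, and a set that contains \<open>a\<close> but not
  \<open>t\<close> has probability exactly \<open>\<pi> a\<close> (lemma \<open>two_point_measure_in_credal_set\<close>).\<close>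

lemma induced_possibility_upper:
  assumes "finite A" "x \<in> A"
  shows "\<pi> x \<le> induced_possibility \<pi> A"
  using assms by (auto simp: induced_possibility_def)

lemma induced_possibility_nonneg:
  assumes "finite A" "\<And>x. x \<in> A \<Longrightarrow> 0 \<le> \<pi> x"
  shows "0 \<le> induced_possibility \<pi> A"
proof (cases "A = {}")
  case False
  then obtain x where "x \<in> A" by blast
  then show ?thesis
    using assms induced_possibility_upper[of A x \<pi>] by (meson order_trans)
qed (simp add: induced_possibility_def)

lemma induced_possibility_attained:
  assumes "finite A" "A \<noteq> {}"
  obtains a where "a \<in> A" "\<pi> a = induced_possibility \<pi> A"
proof -
  have "Max (\<pi> ` A) \<in> \<pi> ` A"
    using assms by (intro Max_in) auto
  then obtain a where "a \<in> A" "Max (\<pi> ` A) = \<pi> a"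
    by (rule imageE)
  then show ?thesis
    using that assms(2) by (simp add: induced_possibility_def)
qed

lemma induced_possibility_cong:
  assumes "\<And>x. x \<in> A \<Longrightarrow> \<pi> x = \<rho> x"
  shows "induced_possibility \<pi> A = induced_possibility \<rho> A"
proof -
  have "\<pi> ` A = \<rho> ` A"
    using assms by (rule image_cong[OF refl])
  then show ?thesis
    by (simp add: induced_possibility_def)
qed

lemma possibility_measure_cong:
  assumes "\<And>A. A \<subseteq> X \<Longrightarrow> P A = P' A"
  shows "possibility_measure X P \<longleftrightarrow> possibility_measure X P'"
  using assms by (simp add: possibility_measure_def)

text \<open>The value on the singleton of \<open>x\<close> is the possibility of \<open>x\<close>, so there is a single candidate for the
  distribution; the bounds and the normalisation required of it can be read off \<open>P\<close>.\<close>

lemma possibility_measure_iff_induced_by_singletons: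
  assumes X: "X \<noteq> {}"
    and bounds: "\<And>x. x \<in> X \<Longrightarrow> P {x} \<in> {0..1}"
    and normalised: "P X = 1"
  shows "possibility_measure X P \<longleftrightarrow> (\<forall>A\<subseteq>X. P A = induced_possibility (\<lambda>x. P {x}) A)"
proof
  assume "possibility_measure X P"
  then obtain \<pi> where \<pi>: "\<And>A. A \<subseteq> X \<Longrightarrow> P A = induced_possibility \<pi> A"
    by (auto simp: possibility_measure_def)
  have "\<pi> x = P {x}" if "x \<in> X" for x
    using \<pi>[of "{x}"] that by (simp add: induced_possibility_def)
  then have "induced_possibility \<pi> A = induced_possibility (\<lambda>x. P {x}) A" if "A \<subseteq> X" for A
    using that by (intro induced_possibility_cong) auto
  then show "\<forall>A\<subseteq>X. P A = induced_possibility (\<lambda>x. P {x}) A"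
    using \<pi> by simp
next
  assume P: "\<forall>A\<subseteq>X. P A = induced_possibility (\<lambda>x. P {x}) A"
  then have "P X = induced_possibility (\<lambda>x. P {x}) X"
    by blast
  then have "Max ((\<lambda>x. P {x}) ` X) = 1"
    using X normalised by (simp add: induced_possibility_def)
  then have "possibility_distribution X (\<lambda>x. P {x})"
    using X bounds by (simp add: possibility_distribution_def)
  then show "possibility_measure X P"
    using P unfolding possibility_measure_def by blast
qed

definition two_point_measure :: "real \<Rightarrow> 'a \<Rightarrow> 'a \<Rightarrow> 'a set \<Rightarrow> real" where
  "two_point_measure c a t B = c * indicator B a + (1 - c) * indicator B t"

lemma fin_additive_probability_two_point_measure:
  assumes "a \<in> X" "t \<in> X" "0 \<le> c" "c \<le> 1"
  shows "fin_additive_probability X (two_point_measure c a t)"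
  using assms
  by (auto simp: fin_additive_probability_def two_point_measure_def Measure_Space.additive_def
      indicator_def)

lemma two_point_measure_in_credal_set:
  assumes fin: "finite X" and dist: "possibility_distribution X \<pi>"
    and a: "a \<in> X" and t: "t \<in> X" "\<pi> t = 1"
  shows "two_point_measure (\<pi> a) a t \<in> credal_set X (induced_possibility \<pi>)"
proof -
  have range: "0 \<le> \<pi> x" "\<pi> x \<le> 1" if "x \<in> X" for x
    using dist that by (auto simp: possibility_distribution_def)
  have "two_point_measure (\<pi> a) a t B \<le> induced_possibility \<pi> B" if B: "B \<subseteq> X" for B
  proof -
    have finB: "finite B"
      using fin B by (rule rev_finite_subset)
    consider "t \<in> B" | "t \<notin> B" "a \<in> B" | "t \<notin> B" "a \<notin> B" by blast
    then show ?thesis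
    proof cases
      case 1
      then have "two_point_measure (\<pi> a) a t B \<le> \<pi> t"
        using range[OF a] t by (simp add: two_point_measure_def indicator_def)
      also have "\<dots> \<le> induced_possibility \<pi> B"
        using finB 1 by (rule induced_possibility_upper)
      finally show ?thesis .
    next
      case 2
      then show ?thesis
        using induced_possibility_upper[OF finB, of a \<pi>] by (simp add: two_point_measure_def)
    next
      case 3
      then show ?thesis
        using induced_possibility_nonneg[OF finB, of \<pi>] range B
        by (auto simp: two_point_measure_def)
    qed
  qed
  then show ?thesis
    using fin_additive_probability_two_point_measure[OF a t(1)] range[OF a]
    by (simp add: credal_set_def)
qed

lemma induced_possibility_attained_in_credal_set:
  assumes fin: "finite X" and dist: "possibility_distribution X \<pi>" and A: "A \<subseteq> X"
  obtains Q where "Q \<in> credal_set X (induced_possibility \<pi>)" "Q A = induced_possibility \<pi> A"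
proof -
  have X: "X \<noteq> {}" "Max (\<pi> ` X) = 1"
    using dist by (auto simp: possibility_distribution_def)
  then obtain t where t: "t \<in> X" "\<pi> t = 1"
    using induced_possibility_attained[OF fin X(1), of \<pi>] by (auto simp: induced_possibility_def)
  show thesis
  proof (cases "A = {}")
    case True
    then have "two_point_measure (\<pi> t) t t A = induced_possibility \<pi> A"
      by (simp add: two_point_measure_def induced_possibility_def)
    then show thesis
      using that two_point_measure_in_credal_set[OF fin dist t(1) t] by blast
  next
    case False
    then obtain a where a: "a \<in> A" "\<pi> a = induced_possibility \<pi> A"
      using induced_possibility_attained fin A by (metis rev_finite_subset)
    have "a \<in> X"
      using a A by blast
    let ?Q = "two_point_measure (\<pi> a) a t"
    have Q: "?Q \<in> credal_set X (induced_possibility \<pi>)"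
      using fin dist \<open>a \<in> X\<close> t by (rule two_point_measure_in_credal_set)
    \<comment> \<open>If \<open>t\<close> lies in \<open>A\<close> as well, then \<open>\<pi> a = 1\<close> and no mass is left for \<open>t\<close>; the two
      inequalities below cover this case without singling it out.\<close>
    have "?Q A \<le> induced_possibility \<pi> A"
      using Q A by (simp add: credal_set_def)
    moreover have "\<pi> a \<le> 1"
      using dist \<open>a \<in> X\<close> by (auto simp: possibility_distribution_def)
    then have "\<pi> a \<le> ?Q A"
      using a(1) by (simp add: two_point_measure_def indicator_def)
    ultimately show thesis
      using that[OF Q] a(2) by simp
  qed
qed

lemma natural_extension_eq_of_attained:
  assumes "Q \<in> credal_set X P" "Q A = P A" "A \<subseteq> X"
  shows "natural_extension X P A = P A"
  unfolding natural_extension_def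
proof (rule Greatest_equality)
  show "P A \<in> (\<lambda>Q. Q A) ` credal_set X P"
    using assms(1) assms(2)[symmetric] by blast
next
  fix v
  assume "v \<in> (\<lambda>Q. Q A) ` credal_set X P"
  then show "v \<le> P A"
    using assms(3) by (auto simp: credal_set_def)
qed

text \<open>In the terminology of imprecise probabilities: possibility measures are coherent upper
  probabilities.\<close>

lemma possibility_measure_coherent:
  assumes fin: "finite X" and poss: "possibility_measure X P"
  shows "avoids_sure_loss X P" and "\<And>A. A \<subseteq> X \<Longrightarrow> natural_extension X P A = P A"
proof -
  obtain \<pi> where dist: "possibility_distribution X \<pi>"
    and P: "\<And>A. A \<subseteq> X \<Longrightarrow> P A = induced_possibility \<pi> A"
    using poss by (auto simp: possibility_measure_def)
  have credal: "credal_set X P = credal_set X (induced_possibility \<pi>)"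
    using P by (simp add: credal_set_def)
  have attained: "\<exists>Q\<in>credal_set X P. Q A = P A" if "A \<subseteq> X" for A
    using induced_possibility_attained_in_credal_set[OF fin dist that] P[OF that] credal by metis
  show "avoids_sure_loss X P"
    using attained[of X] by (auto simp: avoids_sure_loss_def)
  show "natural_extension X P A = P A" if "A \<subseteq> X" for A
    using attained[OF that] natural_extension_eq_of_attained that by blast
qed

theorem theorem14:
  fixes X :: "'a set"
    and \<pi>\<^sub>1 \<pi>\<^sub>2 :: "'a \<Rightarrow> real"
    and P :: "'a set \<Rightarrow> real"
  assumes "finite X"
    and "possibility_distribution X \<pi>\<^sub>1"
    and "possibility_distribution X \<pi>\<^sub>2"
    and "\<And>A. A \<subseteq> X \<Longrightarrow> P A = min (induced_possibility \<pi>\<^sub>1 A) (induced_possibility \<pi>\<^sub>2 A)"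
  shows "(possibility_measure X P \<longleftrightarrow>
           (\<forall>A. A \<subseteq> X \<and> A \<noteq> {} \<longrightarrow>
              min (MAX x\<in>A. \<pi>\<^sub>1 x) (MAX x\<in>A. \<pi>\<^sub>2 x) = (MAX x\<in>A. min (\<pi>\<^sub>1 x) (\<pi>\<^sub>2 x))))
       \<and> (possibility_measure X P \<longrightarrow>
           avoids_sure_loss X P \<and>
           (\<forall>A\<subseteq>X. natural_extension X P A = P A) \<and>
           possibility_measure X (natural_extension X P))"
proof -
  have X: "X \<noteq> {}"
    and dist: "Max (\<pi>\<^sub>1 ` X) = 1" "Max (\<pi>\<^sub>2 ` X) = 1"
    and range: "\<And>x. x \<in> X \<Longrightarrow> \<pi>\<^sub>1 x \<in> {0..1} \<and> \<pi>\<^sub>2 x \<in> {0..1}"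
    using assms(2,3) by (auto simp: possibility_distribution_def)
  have singleton: "P {x} = min (\<pi>\<^sub>1 x) (\<pi>\<^sub>2 x)" if "x \<in> X" for x
    using assms(4)[of "{x}"] that by (simp add: induced_possibility_def)
  have bounds: "P {x} \<in> {0..1}" if "x \<in> X" for x
    using singleton[OF that] range[OF that] by (auto simp: min_def)
  have "P X = 1"
    using assms(4)[of X] X dist by (simp add: induced_possibility_def)
  then have "possibility_measure X P \<longleftrightarrow> (\<forall>A\<subseteq>X. P A = induced_possibility (\<lambda>x. P {x}) A)"
    using X bounds by (intro possibility_measure_iff_induced_by_singletons)
  moreover have "P A = induced_possibility (\<lambda>x. P {x}) A \<longleftrightarrow>
      (A \<noteq> {} \<longrightarrow> min (MAX x\<in>A. \<pi>\<^sub>1 x) (MAX x\<in>A. \<pi>\<^sub>2 x) = (MAX x\<in>A. min (\<pi>\<^sub>1 x) (\<pi>\<^sub>2 x)))"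
    if A: "A \<subseteq> X" for A
  proof -
    have "induced_possibility (\<lambda>x. P {x}) A = induced_possibility (\<lambda>x. min (\<pi>\<^sub>1 x) (\<pi>\<^sub>2 x)) A"
      using A singleton by (intro induced_possibility_cong) auto
    then show ?thesis
      using assms(4)[OF A] by (simp add: induced_possibility_def)
  qed
  ultimately have iff: "possibility_measure X P \<longleftrightarrow>
      (\<forall>A. A \<subseteq> X \<and> A \<noteq> {} \<longrightarrow>
         min (MAX x\<in>A. \<pi>\<^sub>1 x) (MAX x\<in>A. \<pi>\<^sub>2 x) = (MAX x\<in>A. min (\<pi>\<^sub>1 x) (\<pi>\<^sub>2 x)))"
    by blast
  have "avoids_sure_loss X P \<and> (\<forall>A\<subseteq>X. natural_extension X P A = P A) \<and>
      possibility_measure X (natural_extension X P)"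
    if poss: "possibility_measure X P"
    using possibility_measure_coherent[OF assms(1) poss] poss
      possibility_measure_cong[of X "natural_extension X P" P] by blast
  then show ?thesis
    using iff by blast
qed

end
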